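(* Let $(S,\cdot,{}')$ be an epigroup, regarded as a unary semigroup with its pseudoinverse operation $x\mapsto x'$. For each $c\in S$, the unary variant $(S,\cdot_c,{}^{\ast})$, where $x\cdot_c y = xcy$ and $x^{\ast} = (xc)'\,x\,(cx)'$, is an epigroup. If $(S,\cdot,{}')\in\mathcal{V}_n$ for some integer $n>0$, then $(S,\cdot_c,{}^{\ast})\in\mathcal{V}_n$ for each $c\in S$. Therefore, for each $n\in\mathbb{N}$ (that is, $n\ge 1$), the variety $\mathcal{V}_n$ is closed under taking variants.
   Context: An element $a$ of a semigroup $S$ is an epigroup element if there is a positive integer $n$ such that $a^n$ lies in a subgroup of $S$, i.e. the $\mathcal{H}$-class $H_{a^n}$ is a group. If $e$ is the identity of $H_{a^n}$, then $ae\in H_{a^n}$ and the pseudoinverse of $a$ is $a'=(ae)^{-1}$, the inverse being taken in the group $H_{a^n}$. A semigroup is an epigroup if all its elements are epigroup elements. An epigroup is viewed as a unary semigroup $(S,\cdot,{}')$, where ${}'$ is the pseudoinverse operation; accordingly, saying that a unary semigroup $(S,\cdot,{}')$ is an epigroup means that $(S,\cdot)$ is an epigroup and ${}'$ is its pseudoinverse operation. For an epigroup $(S,\cdot,{}')$ and $c\in S$, the unary variant of $S$ at $c$ is $(S,\cdot_c,{}^{\ast})$ with $x\cdot_c y=xcy$ and $x^{\ast}=(xc)'x(cx)'$. For each integer $n\ge 1$, $\mathcal{V}_n$ is the variety of unary semigroups (associative binary operation plus a unary operation ${}'$) satisfying the identities $x'xx'=x'$, $xx'=x'x$, $xy^{n-1}y''=xy^n$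 and $x''x^{n-1}y=x^ny$. For $n=1$ the factors with exponent $n-1=0$ are omitted, so the last two identities read $xy''=xy$ and $x''y=xy$. *)

theory Defs
  imports "HOL-Algebra.Group"
begin

text \<open>
  A semigroup is a binary operation \<open>m\<close> on a type \<open>'a\<close> satisfying the library's locale predicate
  \<^term>\<open>semigroup\<close>; a unary semigroup has in addition an operation \<open>u\<close> of type \<open>'a \<Rightarrow> 'a\<close>.
  A semigroup need not have an identity. The product of \<open>k\<close> copies of \<open>a\<close> followed by \<open>b\<close> is
  \<open>(m a ^^ k) b\<close>, where the factor \<open>a\<^sup>k\<close> is omitted for \<open>k = 0\<close>.
\<close>

text \<open>Used only for exponents \<open>n \<ge> 1\<close>; at \<open>n = 0\<close> the value is \<open>a\<close>.\<close>

definition spow :: "('a \<Rightarrow> 'a \<Rightarrow> 'a) \<Rightarrow> 'a \<Rightarrow> nat \<Rightarrow> 'a" where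
  "spow m a n = (m a ^^ (n - 1)) a"

text \<open>Green's relations; \<open>insert a (range \<dots>)\<close> is the principal one-sided ideal generated by \<open>a\<close>.\<close>

definition green_L :: "('a \<Rightarrow> 'a \<Rightarrow> 'a) \<Rightarrow> 'a \<Rightarrow> 'a \<Rightarrow> bool" where
  "green_L m a b \<longleftrightarrow> insert a (range (\<lambda>x. m x a)) = insert b (range (\<lambda>x. m x b))"

definition green_R :: "('a \<Rightarrow> 'a \<Rightarrow> 'a) \<Rightarrow> 'a \<Rightarrow> 'a \<Rightarrow> bool" where
  "green_R m a b \<longleftrightarrow> insert a (range (\<lambda>x. m a x)) = insert b (range (\<lambda>x. m b x))"

definition green_H_class :: "('a \<Rightarrow> 'a \<Rightarrow> 'a) \<Rightarrow> 'a \<Rightarrow> 'a set" where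
  "green_H_class m a = {b. green_L m a b \<and> green_R m a b}"

text \<open>The \<open>H\<close>-class of \<open>a\<close> under \<open>m\<close>, with \<open>e\<close> proposed as identity element.\<close>

definition H_monoid :: "('a \<Rightarrow> 'a \<Rightarrow> 'a) \<Rightarrow> 'a \<Rightarrow> 'a \<Rightarrow> 'a monoid" where
  "H_monoid m a e = \<lparr>carrier = green_H_class m a, monoid.mult = m, one = e\<rparr>"

definition epigroup_element :: "('a \<Rightarrow> 'a \<Rightarrow> 'a) \<Rightarrow> 'a \<Rightarrow> bool" where
  "epigroup_element m a \<longleftrightarrow> (\<exists>n>0. \<exists>e. group (H_monoid m (spow m a n) e))"

text \<open>
  In a semigroup the witness \<open>b\<close> does not depend on the choice of \<open>n\<close>, and \<open>m a e\<close> always lies in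
  the group; the membership conjunct only makes explicit that the inverse is well defined.
\<close>

definition is_pseudoinverse :: "('a \<Rightarrow> 'a \<Rightarrow> 'a) \<Rightarrow> 'a \<Rightarrow> 'a \<Rightarrow> bool" where
  "is_pseudoinverse m a b \<longleftrightarrow>
     (\<exists>n>0. \<exists>e. group (H_monoid m (spow m a n) e) \<and>
        m a e \<in> green_H_class m (spow m a n) \<and>
        b = inv\<^bsub>H_monoid m (spow m a n) e\<^esub> (m a e))"

definition epigroup :: "('a \<Rightarrow> 'a \<Rightarrow> 'a) \<Rightarrow> bool" where
  "epigroup m \<longleftrightarrow> semigroup m \<and> (\<forall>a. epigroup_element m a)"

definition unary_epigroup :: "('a \<Rightarrow> 'a \<Rightarrow> 'a) \<Rightarrow> ('a \<Rightarrow> 'a) \<Rightarrow> bool" where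
  "unary_epigroup m u \<longleftrightarrow> epigroup m \<and> (\<forall>a. is_pseudoinverse m a (u a))"

definition variant_mult :: "('a \<Rightarrow> 'a \<Rightarrow> 'a) \<Rightarrow> 'a \<Rightarrow> 'a \<Rightarrow> 'a \<Rightarrow> 'a" where
  "variant_mult m c x y = m (m x c) y"

definition variant_inv :: "('a \<Rightarrow> 'a \<Rightarrow> 'a) \<Rightarrow> ('a \<Rightarrow> 'a) \<Rightarrow> 'a \<Rightarrow> 'a \<Rightarrow> 'a" where
  "variant_inv m u c x = m (m (u (m x c)) x) (u (m c x))"

text \<open>
  Membership of \<open>(m, u)\<close> in the variety \<open>V\<^sub>n\<close>, meaningful for \<open>n \<ge> 1\<close>. The last two identities are
  \<open>x y\<^sup>n\<^sup>-\<^sup>1 y'' = x y\<^sup>n\<close> and \<open>x'' x\<^sup>n\<^sup>-\<^sup>1 y = x\<^sup>n y\<close>.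
\<close>

definition in_variety :: "nat \<Rightarrow> ('a \<Rightarrow> 'a \<Rightarrow> 'a) \<Rightarrow> ('a \<Rightarrow> 'a) \<Rightarrow> bool" where
  "in_variety n m u \<longleftrightarrow>
     semigroup m \<and>
     (\<forall>x. m (m (u x) x) (u x) = u x) \<and>
     (\<forall>x. m x (u x) = m (u x) x) \<and>
     (\<forall>x y. m x ((m y ^^ (n - 1)) (u (u y))) = m x (spow m y n)) \<and>
     (\<forall>x y. m (u (u x)) ((m x ^^ (n - 1)) y) = m (spow m x n) y)"

end

theory Submission
  imports Defs
begin

text \<open>
  The pseudoinverse of \<open>a\<close> is its Drazin inverse: the only \<open>b\<close> with \<open>ab = ba\<close>, \<open>bab = b\<close> and
  \<open>a\<^sup>kab = a\<^sup>k\<close> for some \<open>k \<ge> 1\<close>. The identities of \<open>V\<^sub>n\<close> force \<open>a'\<close> to be the Drazin inverse of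
  \<open>a\<close>, so both settings can be treated alike. Cline's formula \<open>(xc)' = x(cx)'(cx)'c\<close> gives
  \<open>x\<^sup>*c = (xc)'\<close> and \<open>cx\<^sup>* = (cx)'\<close>, and every identity for the variant then reduces to the
  corresponding one for \<open>xc\<close> or \<open>cx\<close> in \<open>S\<close>.
\<close>

definition drazin_inverse :: "('a \<Rightarrow> 'a \<Rightarrow> 'a) \<Rightarrow> 'a \<Rightarrow> 'a \<Rightarrow> bool" where
  "drazin_inverse m a b \<longleftrightarrow>
     m a b = m b a \<and> m (m b a) b = b \<and> (\<exists>k>0. m (spow m a k) (m a b) = spow m a k)"

context semigroup
begin

section \<open>Powers of commuting elements and uniqueness of Drazin inverses\<close>

lemma funpow_mult_right: "((\<^bold>*) a ^^ k) b \<^bold>* y = ((\<^bold>*) a ^^ k) (b \<^bold>* y)"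
  by (induction k) (simp_all add: assoc)

text \<open>Reassociation turns \<open>c(xc)^k\<close> into \<open>(cx)^k c\<close>. This trades
  powers of \<open>xc\<close> for powers of \<open>cx\<close>, both in Cline's formula and in the
  identities of the variant.\<close>

lemma funpow_shift: "c \<^bold>* ((\<^bold>*) (x \<^bold>* c) ^^ k) y = ((\<^bold>*) (c \<^bold>* x) ^^ k) (c \<^bold>* y)"
  by (induction k) (simp_all add: assoc)

lemma spow_1: "spow (\<^bold>*) a (Suc 0) = a"
  by (simp add: spow_def)

lemma spow_Suc: "0 < k \<Longrightarrow> spow (\<^bold>*) a (Suc k) = a \<^bold>* spow (\<^bold>*) a k"
  by (cases k) (simp_all add: spow_def)

lemma spow_mult: "0 < k \<Longrightarrow> spow (\<^bold>*) a k \<^bold>* b = ((\<^bold>*) a ^^ k) b"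
  by (cases k) (simp_all add: spow_def funpow_mult_right funpow_swap1)

lemma spow_commute:
  assumes "a \<^bold>* b = b \<^bold>* a" "0 < k"
  shows "spow (\<^bold>*) a k \<^bold>* b = b \<^bold>* spow (\<^bold>*) a k"
  using assms(2)
proof (induction k rule: nat_induct_non_zero)
  case 1
  then show ?case using assms(1) by (simp add: spow_1)
next
  case (Suc k)
  have "spow (\<^bold>*) a (Suc k) \<^bold>* b = (a \<^bold>* b) \<^bold>* spow (\<^bold>*) a k"
    using Suc by (simp add: spow_Suc assoc)
  then show ?case
    using Suc assms(1) by (simp add: spow_Suc assoc)
qed

lemma spow_Suc2: "0 < k \<Longrightarrow> spow (\<^bold>*) a (Suc k) = spow (\<^bold>*) a k \<^bold>* a"
  by (simp add: spow_Suc spow_commute)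

text \<open>The product collapses from the inside: \<open>a(ab)b = a(bab) = ab\<close>. So
  \<open>b^k\<close> reduces \<open>a^k\<close> to the same idempotent for every
  \<open>k\<close>.\<close>

lemma spow_mult_spow:
  assumes "a \<^bold>* b = b \<^bold>* a" "b \<^bold>* a \<^bold>* b = b" "0 < k"
  shows "spow (\<^bold>*) a k \<^bold>* spow (\<^bold>*) b k = a \<^bold>* b"
  using assms(3)
proof (induction k rule: nat_induct_non_zero)
  case 1
  then show ?case by (simp add: spow_1)
next
  case (Suc k)
  have "spow (\<^bold>*) a (Suc k) \<^bold>* spow (\<^bold>*) b (Suc k)
      = a \<^bold>* (spow (\<^bold>*) a k \<^bold>* spow (\<^bold>*) b k) \<^bold>* b"
    using Suc.hyps by (simp add: spow_Suc[of k a] spow_Suc2[of k b] assoc)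
  also have "\<dots> = a \<^bold>* (a \<^bold>* b) \<^bold>* b"
    by (simp only: Suc.IH)
  also have "\<dots> = a \<^bold>* (b \<^bold>* a \<^bold>* b)"
    unfolding assms(1) by (simp add: assoc)
  finally show ?case using assms(2) by simp
qed

text \<open>The exponents are used crosswise. From \<open>ba = b^l a^l\<close> and
  \<open>a^l ac = a^l\<close> follows \<open>ba = ba ac\<close>; from \<open>ac = a^k c^k\<close>
  and \<open>ab a^k = a^k\<close> follows \<open>ac = ab ac\<close>. Hence \<open>ab = ac\<close>,
  and then \<open>b = bab = bac = acc = c\<close>.\<close>

lemma drazin_inverse_unique:
  assumes b: "drazin_inverse (\<^bold>*) a b" and c: "drazin_inverse (\<^bold>*) a c"
  shows "b = c"
proof -
  obtain k where k: "k > 0" "spow (\<^bold>*) a k \<^bold>* (a \<^bold>* b) = spow (\<^bold>*) a k"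
    using b by (auto simp: drazin_inverse_def)
  obtain l where l: "l > 0" "spow (\<^bold>*) a l \<^bold>* (a \<^bold>* c) = spow (\<^bold>*) a l"
    using c by (auto simp: drazin_inverse_def)
  have b': "a \<^bold>* b = b \<^bold>* a" "b \<^bold>* a \<^bold>* b = b" and c': "a \<^bold>* c = c \<^bold>* a" "c \<^bold>* a \<^bold>* c = c"
    using b c by (auto simp: drazin_inverse_def)
  have "b \<^bold>* a = spow (\<^bold>*) b l \<^bold>* spow (\<^bold>*) a l"
    using spow_mult_spow[of b a l] spow_mult_spow[of a b l] l(1) b' spow_commute
    by metis
  then have 1: "b \<^bold>* a = b \<^bold>* a \<^bold>* (a \<^bold>* c)"
    using l(2) by (metis assoc)
  have "spow (\<^bold>*) a k \<^bold>* (a \<^bold>* b) = (a \<^bold>* b) \<^bold>* spow (\<^bold>*) a k"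
    by (rule spow_commute[OF _ k(1)]) (metis assoc b'(1))
  moreover have "a \<^bold>* c = spow (\<^bold>*) a k \<^bold>* spow (\<^bold>*) c k"
    using spow_mult_spow[OF c' k(1)] by simp
  ultimately have 2: "a \<^bold>* c = a \<^bold>* b \<^bold>* (a \<^bold>* c)"
    using k(2) by (metis assoc)
  have eq: "a \<^bold>* b = a \<^bold>* c"
    using 1 2 b'(1) by simp
  have "b = b \<^bold>* (a \<^bold>* c)"
    using b'(2) eq by (metis assoc)
  also have "\<dots> = a \<^bold>* c \<^bold>* c"
    using b'(1) eq by (metis assoc)
  finally show "b = c" using c' by simp
qed

section \<open>H-classes of idempotents\<close>

text \<open>An idempotent \<open>e\<close> generates the ideals \<open>Se\<close> and
  \<open>eS\<close>, and \<open>h\<close> lies in them exactly if \<open>he = h\<close> and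
  \<open>eh = h\<close>. The two existential conditions place \<open>e\<close> in the ideals
  generated by \<open>h\<close>.\<close>

lemma green_H_class_idem:
  assumes e: "e \<^bold>* e = e"
  shows "h \<in> green_H_class (\<^bold>*) e \<longleftrightarrow>
    e \<^bold>* h = h \<and> h \<^bold>* e = h \<and> (\<exists>x. x \<^bold>* h = e) \<and> (\<exists>y. h \<^bold>* y = e)" (is "_ \<longleftrightarrow> ?R")
proof
  assume "h \<in> green_H_class (\<^bold>*) e"
  then have L: "insert e (range (\<lambda>x. x \<^bold>* e)) = insert h (range (\<lambda>x. x \<^bold>* h))"
    and R: "insert e (range (\<lambda>x. e \<^bold>* x)) = insert h (range (\<lambda>x. h \<^bold>* x))"
    by (auto simp: green_H_class_def green_L_def green_R_def)
  have 1: "h \<in> insert e (range (\<lambda>x. x \<^bold>* e))" "e \<in> insert h (range (\<lambda>x. x \<^bold>* h))"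
    using L by blast+
  have 2: "h \<in> insert e (range (\<lambda>x. e \<^bold>* x))" "e \<in> insert h (range (\<lambda>x. h \<^bold>* x))"
    using R by blast+
  have "h \<^bold>* e = h" using 1(1) e by (auto simp: assoc)
  moreover have "e \<^bold>* h = h" using 2(1) e by (auto simp: assoc[symmetric])
  moreover have "\<exists>x. x \<^bold>* h = e" using 1(2) e by auto
  moreover have "\<exists>x. h \<^bold>* x = e" using 2(2) e by auto
  ultimately show ?R by blast
next
  assume ?R
  then obtain x y where h: "e \<^bold>* h = h" "h \<^bold>* e = h" "x \<^bold>* h = e" "h \<^bold>* y = e" by blast
  \<comment> \<open>Each generator is its own product with \<open>e\<close>, so
    \<open>insert\<close> adds nothing and only the ranges have to be compared.\<close>
  have absorb: "insert z (range F) = range F" if "F w = z" for z w and F :: "'a \<Rightarrow> 'a"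
    using that by auto
  have "insert e (range (\<lambda>x. x \<^bold>* e)) = range (\<lambda>x. x \<^bold>* e)"
    and "insert h (range (\<lambda>x. x \<^bold>* h)) = range (\<lambda>x. x \<^bold>* h)"
    and "insert e (range (\<lambda>x. e \<^bold>* x)) = range (\<lambda>x. e \<^bold>* x)"
    and "insert h (range (\<lambda>x. h \<^bold>* x)) = range (\<lambda>x. h \<^bold>* x)"
    by (rule absorb[where w = e]; simp add: e h)+
  moreover have "range (\<lambda>x. x \<^bold>* e) = range (\<lambda>x. x \<^bold>* h)"
    using h by (auto, metis assoc rangeI, metis assoc rangeI)
  moreover have "range (\<lambda>x. e \<^bold>* x) = range (\<lambda>x. h \<^bold>* x)"
    using h by (auto, metis assoc rangeI, metis assoc rangeI)
  ultimately show "h \<in> green_H_class (\<^bold>*) e"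
    by (simp add: green_H_class_def green_L_def green_R_def)
qed

text \<open>Members of the class are fixed by \<open>e\<close> on both sides and have one-sided
  inverses relative to \<open>e\<close>. These compose, which gives closure, and they merge into
  two-sided inverses.\<close>

lemma group_H_monoid_idem:
  assumes e: "e \<^bold>* e = e"
  shows "group (H_monoid (\<^bold>*) e e)"
proof (rule groupI)
  fix h g assume "h \<in> carrier (H_monoid (\<^bold>*) e e)" "g \<in> carrier (H_monoid (\<^bold>*) e e)"
  then obtain x y z w where h: "e \<^bold>* h = h" "h \<^bold>* e = h" "x \<^bold>* h = e" "h \<^bold>* y = e"
    and g: "e \<^bold>* g = g" "g \<^bold>* e = g" "z \<^bold>* g = e" "g \<^bold>* w = e"
    by (auto simp: H_monoid_def green_H_class_idem[OF e])
  have "(z \<^bold>* x) \<^bold>* (h \<^bold>* g) = e" by (metis assoc h(3) g(1,3))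
  moreover have "(h \<^bold>* g) \<^bold>* (w \<^bold>* y) = e" by (metis assoc h(2,4) g(4))
  moreover have "e \<^bold>* (h \<^bold>* g) = h \<^bold>* g" "(h \<^bold>* g) \<^bold>* e = h \<^bold>* g"
    using h g by (simp add: assoc[symmetric], simp add: assoc)
  ultimately show "h \<otimes>\<^bsub>H_monoid (\<^bold>*) e e\<^esub> g \<in> carrier (H_monoid (\<^bold>*) e e)"
    by (auto simp: H_monoid_def green_H_class_idem[OF e])
next
  fix h assume "h \<in> carrier (H_monoid (\<^bold>*) e e)"
  then obtain x y where h: "e \<^bold>* h = h" "h \<^bold>* e = h" "x \<^bold>* h = e" "h \<^bold>* y = e"
    by (auto simp: H_monoid_def green_H_class_idem[OF e])
  \<comment> \<open>The elements \<open>x\<close> and \<open>y\<close> may lie outside the class,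
    but \<open>ey = xhy = xe\<close> is fixed by \<open>e\<close> on both sides and inverts
    \<open>h\<close> on both sides.\<close>
  define z where "z = e \<^bold>* y"
  have hz: "h \<^bold>* z = e" by (metis assoc h(2,4) z_def)
  have "z = x \<^bold>* h \<^bold>* y" by (simp add: z_def h)
  then have xz: "z = x \<^bold>* e" using h(4) by (simp add: assoc)
  have zh: "z \<^bold>* h = e" by (metis assoc h(1,3) xz)
  have "e \<^bold>* z = z" "z \<^bold>* e = z"
    using e by (simp add: z_def assoc[symmetric], simp add: xz assoc)
  then have "z \<in> carrier (H_monoid (\<^bold>*) e e)"
    using hz zh by (auto simp: H_monoid_def green_H_class_idem[OF e])
  then show "\<exists>z\<in>carrier (H_monoid (\<^bold>*) e e). z \<otimes>\<^bsub>H_monoid (\<^bold>*) e e\<^esub> h = \<one>\<^bsub>H_monoid (\<^bold>*) e e\<^esub>"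
    using zh by (auto simp: H_monoid_def)
qed (use e in \<open>auto simp: H_monoid_def green_H_class_idem[OF e] assoc\<close>)

section \<open>Pseudoinverses and Drazin inverses\<close>

text \<open>In the group, \<open>b\<close> inverts \<open>ae\<close>. Once \<open>e\<close> is known
  to commute with \<open>a\<close>, this yields \<open>ab = e = ba\<close>, and the index condition
  becomes \<open>pe = p\<close> for the group element \<open>p = a^n\<close>.\<close>

lemma is_pseudoinverse_imp_drazin_inverse:
  assumes "is_pseudoinverse (\<^bold>*) a b"
  shows "drazin_inverse (\<^bold>*) a b"
proof -
  obtain n e where n: "n > 0" and G: "group (H_monoid (\<^bold>*) (spow (\<^bold>*) a n) e)"
    and ae: "a \<^bold>* e \<in> green_H_class (\<^bold>*) (spow (\<^bold>*) a n)"
    and b: "b = inv\<^bsub>H_monoid (\<^bold>*) (spow (\<^bold>*) a n) e\<^esub> (a \<^bold>* e)"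
    using assms by (auto simp: is_pseudoinverse_def)
  define p where "p = spow (\<^bold>*) a n"
  define H where "H = H_monoid (\<^bold>*) p e"
  interpret H: group H using G by (simp add: H_def p_def)
  have H_simps: "carrier H = green_H_class (\<^bold>*) p" "\<And>x y. x \<otimes>\<^bsub>H\<^esub> y = x \<^bold>* y" "\<one>\<^bsub>H\<^esub> = e"
    by (simp_all add: H_def H_monoid_def)
  have aeH: "a \<^bold>* e \<in> carrier H" using ae by (simp add: H_simps p_def)
  have pH: "p \<in> carrier H"
    by (simp add: H_simps green_H_class_def green_L_def green_R_def)
  have b': "inv\<^bsub>H\<^esub> (a \<^bold>* e) = b"
    using b by (simp add: H_def p_def)
  have bH: "b \<in> carrier H" and bae: "b \<^bold>* (a \<^bold>* e) = e" "(a \<^bold>* e) \<^bold>* b = e"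
    using H.inv_closed[OF aeH] H.l_inv[OF aeH] H.r_inv[OF aeH] b'
    by (simp_all only: H_simps)
  have eb: "e \<^bold>* b = b" "b \<^bold>* e = b" and ep: "e \<^bold>* p = p" "p \<^bold>* e = p" and eae: "e \<^bold>* (a \<^bold>* e) = a \<^bold>* e"
    using H.l_one H.r_one bH pH aeH by (simp_all add: H_simps)
  define g where "g = inv\<^bsub>H\<^esub> p"
  have gp: "g \<^bold>* p = e"
    using H.l_inv[OF pH] by (simp add: g_def H_simps)
  have pa: "p \<^bold>* a = a \<^bold>* p" using spow_commute[of a a n] n by (simp add: p_def)
  \<comment> \<open>Although \<open>a\<close> may lie outside the group, it commutes with its power
    \<open>p\<close>. Writing \<open>e = gp\<close> lets \<open>p\<close> pass across
    \<open>a\<close>, pick up \<open>e\<close> on the right and return.\<close>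
  have "e \<^bold>* a = g \<^bold>* (a \<^bold>* p)" using gp pa by (metis assoc)
  also have "\<dots> = g \<^bold>* (p \<^bold>* a) \<^bold>* e" using pa ep by (simp add: assoc)
  also have "\<dots> = e \<^bold>* (a \<^bold>* e)" using gp by (metis assoc)
  finally have comm: "e \<^bold>* a = a \<^bold>* e" using eae by simp
  have ab: "a \<^bold>* b = e" using bae(2) eb by (simp add: assoc)
  have ba: "b \<^bold>* a = e" using bae(1) comm eb by (metis assoc)
  show ?thesis
    unfolding drazin_inverse_def using ab ba eb ep n by (auto simp: p_def)
qed

text \<open>The idempotent \<open>e = ab\<close> serves as group identity:
  \<open>a^k b^k = b^k a^k = e\<close> puts \<open>a^k\<close> into the H-class of \<open>e\<close>,
  and there \<open>b\<close> inverts \<open>ae\<close>.\<close>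

lemma drazin_inverse_imp:
  assumes "drazin_inverse (\<^bold>*) a b"
  shows "epigroup_element (\<^bold>*) a" and "is_pseudoinverse (\<^bold>*) a b"
proof -
  obtain k where ab: "a \<^bold>* b = b \<^bold>* a" and bab: "b \<^bold>* a \<^bold>* b = b" and k: "k > 0"
    and idx: "spow (\<^bold>*) a k \<^bold>* (a \<^bold>* b) = spow (\<^bold>*) a k"
    using assms by (auto simp: drazin_inverse_def)
  define e where "e = a \<^bold>* b"
  define p where "p = spow (\<^bold>*) a k"
  have e: "e \<^bold>* e = e" unfolding e_def by (metis ab bab assoc)
  have eb: "e \<^bold>* b = b" "b \<^bold>* e = b" using ab bab by (simp_all add: e_def assoc)
  have ea: "e \<^bold>* a = a \<^bold>* e" unfolding e_def by (metis ab assoc)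
  have pe: "p \<^bold>* e = p" using idx by (simp add: p_def e_def)
  have ep: "e \<^bold>* p = p"
    using spow_commute[of a e k] ea k pe by (simp add: p_def)
  have pb: "p \<^bold>* spow (\<^bold>*) b k = e"
    using spow_mult_spow[OF ab bab k] by (simp add: p_def e_def)
  have "spow (\<^bold>*) a k \<^bold>* b = b \<^bold>* spow (\<^bold>*) a k"
    by (rule spow_commute[OF ab k])
  then have "spow (\<^bold>*) b k \<^bold>* p = e"
    using spow_commute[of b p k] pb k by (simp add: p_def)
  then have "p \<in> green_H_class (\<^bold>*) e"
    using green_H_class_idem[OF e] pe ep pb by blast
  \<comment> \<open>H-related elements have the same H-class, so the group structure found at
    \<open>e\<close> carries over to \<open>p\<close>.\<close>
  then have H: "green_H_class (\<^bold>*) p = green_H_class (\<^bold>*) e"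
    by (auto simp: green_H_class_def green_L_def green_R_def)
  then have M: "H_monoid (\<^bold>*) p e = H_monoid (\<^bold>*) e e"
    by (simp add: H_monoid_def)
  have G: "group (H_monoid (\<^bold>*) p e)"
    using group_H_monoid_idem[OF e] M by simp
  then show "epigroup_element (\<^bold>*) a"
    using k by (auto simp: epigroup_element_def p_def)
  have bae: "b \<^bold>* (a \<^bold>* e) = e" "(a \<^bold>* e) \<^bold>* b = e"
    using e eb by (simp_all add: e_def ab assoc)
  have eae: "e \<^bold>* (a \<^bold>* e) = a \<^bold>* e" "(a \<^bold>* e) \<^bold>* e = a \<^bold>* e"
    using e ea by (metis assoc)+
  have aeH: "a \<^bold>* e \<in> green_H_class (\<^bold>*) e"
    using bae eae by (auto simp: green_H_class_idem[OF e])
  have bH: "b \<in> green_H_class (\<^bold>*) e"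
    using bae eb by (auto simp: green_H_class_idem[OF e])
  have "inv\<^bsub>H_monoid (\<^bold>*) p e\<^esub> (a \<^bold>* e) = b"
    by (rule group.inv_equality[OF G]) (use aeH bH H bae in \<open>simp_all add: H_monoid_def\<close>)
  then show "is_pseudoinverse (\<^bold>*) a b"
    using G aeH H k unfolding is_pseudoinverse_def p_def by metis
qed

section \<open>From \<open>cx\<close> to \<open>xc\<close>, and from identities to Drazin
  inverses\<close>

text \<open>Both products of \<open>xc\<close> with the candidate collapse to \<open>xdc\<close>,
  because \<open>d\<close> commutes with \<open>cx\<close> and \<open>d(cx)d = d\<close>.\<close>

lemma drazin_inverse_swap:
  assumes "drazin_inverse (\<^bold>*) (c \<^bold>* x) d"
  shows "drazin_inverse (\<^bold>*) (x \<^bold>* c) (x \<^bold>* d \<^bold>* d \<^bold>* c)"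
proof -
  obtain k where comm: "(c \<^bold>* x) \<^bold>* d = d \<^bold>* (c \<^bold>* x)" and dd: "d \<^bold>* (c \<^bold>* x) \<^bold>* d = d" and k: "k > 0"
    and idx: "spow (\<^bold>*) (c \<^bold>* x) k \<^bold>* ((c \<^bold>* x) \<^bold>* d) = spow (\<^bold>*) (c \<^bold>* x) k"
    using assms by (auto simp: drazin_inverse_def)
  have l: "(x \<^bold>* c) \<^bold>* (x \<^bold>* d \<^bold>* d \<^bold>* c) = x \<^bold>* d \<^bold>* c"
    by (metis assoc comm dd)
  have r: "(x \<^bold>* d \<^bold>* d \<^bold>* c) \<^bold>* (x \<^bold>* c) = x \<^bold>* d \<^bold>* c"
    by (metis assoc comm dd)
  have "(x \<^bold>* d \<^bold>* c) \<^bold>* (x \<^bold>* d \<^bold>* d \<^bold>* c) = x \<^bold>* (d \<^bold>* (c \<^bold>* x) \<^bold>* d) \<^bold>* d \<^bold>* c"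
    by (simp add: assoc)
  then have rl: "(x \<^bold>* d \<^bold>* c) \<^bold>* (x \<^bold>* d \<^bold>* d \<^bold>* c) = x \<^bold>* d \<^bold>* d \<^bold>* c"
    using dd by simp
  \<comment> \<open>The index grows by one: \<open>k\<close> factors \<open>cx\<close> between an
    \<open>x\<close> and a \<open>c\<close> make \<open>k + 1\<close> factors
    \<open>xc\<close>.\<close>
  have shift: "spow (\<^bold>*) (x \<^bold>* c) (Suc k) = x \<^bold>* spow (\<^bold>*) (c \<^bold>* x) k \<^bold>* c"
    using funpow_shift[where y = c] k
    by (simp add: spow_mult assoc) (simp add: spow_def)
  have "spow (\<^bold>*) (x \<^bold>* c) (Suc k) \<^bold>* (x \<^bold>* d \<^bold>* c)
      = x \<^bold>* (spow (\<^bold>*) (c \<^bold>* x) k \<^bold>* ((c \<^bold>* x) \<^bold>* d)) \<^bold>* c"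
    unfolding shift by (simp add: assoc)
  then show ?thesis
    unfolding drazin_inverse_def l r rl idx shift[symmetric] by blast
qed

text \<open>The index condition is the point. Put \<open>b = a'\<close>, \<open>c = a''\<close> and
  \<open>p = a^n\<close>. The identities give \<open>pc = pa\<close> and then
  \<open>c = baa\<close>, so \<open>c\<close> is fixed by right multiplication by \<open>ab\<close>,
  and therefore so is \<open>pa\<close>.\<close>

lemma in_variety_imp_drazin_inverse:
  assumes n: "n > 0" and V: "in_variety n (\<^bold>*) u"
  shows "drazin_inverse (\<^bold>*) a (u a)"
proof -
  have uxu: "u x \<^bold>* x \<^bold>* u x = u x" and comm: "x \<^bold>* u x = u x \<^bold>* x" for x
    using V by (auto simp: in_variety_def)
  define b where "b = u a"
  define c where "c = u b"
  define p where "p = spow (\<^bold>*) a n"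
  have ab: "a \<^bold>* b = b \<^bold>* a" "b \<^bold>* a \<^bold>* b = b" and bc: "b \<^bold>* c = c \<^bold>* b" "c \<^bold>* b \<^bold>* c = c"
    using uxu comm by (simp_all add: b_def c_def)
  \<comment> \<open>One factor \<open>a\<close> is split off so that the identity with exponent
    \<open>n - 1\<close> applies with both variables equal to \<open>a\<close>.\<close>
  have "p \<^bold>* c = ((\<^bold>*) a ^^ Suc (n - 1)) c"
    using n by (simp add: p_def spow_mult)
  also have "\<dots> = a \<^bold>* p"
    using V by (simp add: in_variety_def p_def c_def b_def)
  finally have pc: "p \<^bold>* c = p \<^bold>* a"
    using spow_commute[of a a n] n by (simp add: p_def)
  \<comment> \<open>Multiplying \<open>pc = pa\<close> by \<open>b^n\<close> on the left replaces
    \<open>p\<close> by the idempotent \<open>ba\<close>.\<close>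
  have "spow (\<^bold>*) b n \<^bold>* p = b \<^bold>* a"
    unfolding p_def
    using spow_mult_spow[OF ab n] spow_commute[OF spow_commute[OF ab(1) n, symmetric] n] ab(1)
    by simp
  then have ec: "b \<^bold>* a \<^bold>* c = b \<^bold>* a \<^bold>* a"
    using pc by (metis assoc)
  have "b \<^bold>* c = b \<^bold>* (b \<^bold>* a \<^bold>* c)" using ab by (metis assoc)
  also have "\<dots> = b \<^bold>* a" unfolding ec using ab by (metis assoc)
  finally have "c = b \<^bold>* a \<^bold>* a"
    using bc ec by simp
  then have "c \<^bold>* (a \<^bold>* b) = c" using ab by (metis assoc)
  then have "p \<^bold>* a \<^bold>* (a \<^bold>* b) = p \<^bold>* a"
    using pc by (metis assoc)
  \<comment> \<open>The fixed element is \<open>pa\<close>, so the exponent obtained is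
    \<open>n + 1\<close>.\<close>
  then have "spow (\<^bold>*) a (Suc n) \<^bold>* (a \<^bold>* b) = spow (\<^bold>*) a (Suc n)"
    using n by (simp add: spow_Suc2 p_def)
  then show ?thesis
    unfolding drazin_inverse_def using ab b_def by blast
qed

section \<open>Variants\<close>

lemma semigroup_variant: "semigroup (variant_mult (\<^bold>*) c)"
  by unfold_locales (simp add: variant_mult_def assoc)

text \<open>Leaving out the second argument lets the equation rewrite iterates under
  \<open>^^\<close>, so powers in the variant become powers of \<open>xc\<close>.\<close>

lemma variant_mult_eq: "variant_mult (\<^bold>*) c x = (\<^bold>*) (x \<^bold>* c)"
  by (simp add: variant_mult_def fun_eq_iff)

context
  fixes u :: "'a \<Rightarrow> 'a"
  assumes drazin: "\<And>a. drazin_inverse (\<^bold>*) a (u a)"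
begin

lemma commute_inv: "x \<^bold>* u x = u x \<^bold>* x" and inv_mult_inv: "u x \<^bold>* x \<^bold>* u x = u x"
  using drazin[of x] by (auto simp: drazin_inverse_def)

lemma cline: "u (x \<^bold>* c) = x \<^bold>* u (c \<^bold>* x) \<^bold>* u (c \<^bold>* x) \<^bold>* c"
  by (rule drazin_inverse_unique[OF drazin drazin_inverse_swap[OF drazin]])

text \<open>Cline's formula leaves \<open>u (cx) u (cx) cx\<close> on the right of \<open>x\<close>,
  which collapses to \<open>u (cx)\<close>.\<close>

lemma inv_mult_left: "u (x \<^bold>* c) \<^bold>* x = x \<^bold>* u (c \<^bold>* x)"
proof -
  have "u (x \<^bold>* c) \<^bold>* x = x \<^bold>* (u (c \<^bold>* x) \<^bold>* (u (c \<^bold>* x) \<^bold>* (c \<^bold>* x)))"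
    unfolding cline[of x c] by (simp add: assoc)
  then show ?thesis
    by (metis assoc commute_inv inv_mult_inv)
qed

lemma variant_inv_eq: "variant_inv (\<^bold>*) u c x = x \<^bold>* u (c \<^bold>* x) \<^bold>* u (c \<^bold>* x)"
  by (simp add: variant_inv_def inv_mult_left)

text \<open>Makes iterated inverses computable: applying \<open>variant_inv\<close> twice and then
  multiplying by \<open>c\<close> on the right gives \<open>u (u (xc))\<close>. The next lemma does
  the same on the left with \<open>cx\<close>.\<close>

lemma variant_inv_mult: "variant_inv (\<^bold>*) u c x \<^bold>* c = u (x \<^bold>* c)"
  unfolding variant_inv_eq cline[of x c] ..

lemma mult_variant_inv: "c \<^bold>* variant_inv (\<^bold>*) u c x = u (c \<^bold>* x)"
  unfolding variant_inv_eq by (metis assoc commute_inv inv_mult_inv)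

text \<open>In the variant, both products of \<open>x\<close> with its inverse equal
  \<open>u (xc) x\<close>; the index condition is inherited from \<open>xc\<close>.\<close>

lemma drazin_inverse_variant:
  "drazin_inverse (variant_mult (\<^bold>*) c) x (variant_inv (\<^bold>*) u c x)"
proof -
  let ?v = "variant_inv (\<^bold>*) u c x"
  have vx: "?v \<^bold>* c \<^bold>* x = u (x \<^bold>* c) \<^bold>* x"
    by (simp add: variant_inv_mult)
  have xv: "x \<^bold>* c \<^bold>* ?v = u (x \<^bold>* c) \<^bold>* x"
    by (simp add: assoc mult_variant_inv inv_mult_left)
  have "u (x \<^bold>* c) \<^bold>* x \<^bold>* c \<^bold>* ?v = u (x \<^bold>* c) \<^bold>* x \<^bold>* u (c \<^bold>* x)"
    by (simp add: assoc mult_variant_inv)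
  then have vxv: "u (x \<^bold>* c) \<^bold>* x \<^bold>* c \<^bold>* ?v = ?v"
    by (simp add: variant_inv_def)
  obtain k where k: "k > 0"
    and idx: "spow (\<^bold>*) (x \<^bold>* c) k \<^bold>* ((x \<^bold>* c) \<^bold>* u (x \<^bold>* c)) = spow (\<^bold>*) (x \<^bold>* c) k"
    using drazin[of "x \<^bold>* c"] by (auto simp: drazin_inverse_def)
  \<comment> \<open>A variant power with \<open>k + 1\<close> factors \<open>x\<close> contains
    \<open>k\<close> factors \<open>c\<close>, so an exponent \<open>k\<close> for \<open>xc\<close>
    yields \<open>Suc k\<close> for \<open>x\<close>.\<close>
  have pow: "spow (variant_mult (\<^bold>*) c) x (Suc k) = spow (\<^bold>*) (x \<^bold>* c) k \<^bold>* x"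
    using k by (simp add: spow_def[of "variant_mult (\<^bold>*) c"] variant_mult_eq spow_mult)
  have "spow (\<^bold>*) (x \<^bold>* c) k \<^bold>* x \<^bold>* c \<^bold>* (u (x \<^bold>* c) \<^bold>* x)
      = spow (\<^bold>*) (x \<^bold>* c) k \<^bold>* ((x \<^bold>* c) \<^bold>* u (x \<^bold>* c)) \<^bold>* x"
    by (simp add: assoc)
  then have "variant_mult (\<^bold>*) c (spow (variant_mult (\<^bold>*) c) x (Suc k)) (variant_mult (\<^bold>*) c x ?v)
      = spow (variant_mult (\<^bold>*) c) x (Suc k)"
    unfolding pow variant_mult_eq xv idx .
  then show ?thesis
    unfolding drazin_inverse_def
    using vx xv vxv by (auto simp: variant_mult_eq)
qed

text \<open>The first two identities are part of being a Drazin inverse in the variant. The third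
  reduces to the identity for \<open>cy\<close> in \<open>S\<close>, the fourth to the one for
  \<open>xc\<close>.\<close>

lemma in_variety_variant:
  assumes n: "n > 0" and V: "in_variety n (\<^bold>*) u"
  shows "in_variety n (variant_mult (\<^bold>*) c) (variant_inv (\<^bold>*) u c)"
proof -
  let ?m = "variant_mult (\<^bold>*) c" and ?v = "variant_inv (\<^bold>*) u c"
  have "?m x ((?m y ^^ (n - 1)) (?v (?v y))) = ?m x (spow ?m y n)" for x y
  proof -
    \<comment> \<open>The \<open>c\<close> next to \<open>x\<close> is moved through the powers of
      \<open>yc\<close>, turning them into powers of \<open>cy\<close>, until it meets the double
      inverse and makes it \<open>u (u (cy))\<close>.\<close>
    have "?m x ((?m y ^^ (n - 1)) (?v (?v y)))
        = x \<^bold>* ((\<^bold>*) (c \<^bold>* y) ^^ (n - 1)) (u (u (c \<^bold>* y)))"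
      by (simp add: variant_mult_eq assoc[of x c] funpow_shift mult_variant_inv)
    also have "\<dots> = x \<^bold>* spow (\<^bold>*) (c \<^bold>* y) n"
      using V by (simp add: in_variety_def)
    also have "\<dots> = ?m x (spow ?m y n)"
      by (simp add: spow_def variant_mult_eq assoc[of x c] funpow_shift)
    finally show ?thesis .
  qed
  moreover have "?m (?v (?v x)) ((?m x ^^ (n - 1)) y) = ?m (spow ?m x n) y" for x y
  proof -
    \<comment> \<open>Here the \<open>c\<close> following the double inverse is already in place and
      makes it \<open>u (u (xc))\<close>.\<close>
    have "?m (?v (?v x)) ((?m x ^^ (n - 1)) y)
        = u (u (x \<^bold>* c)) \<^bold>* ((\<^bold>*) (x \<^bold>* c) ^^ (n - 1)) y"
      by (simp add: variant_mult_eq variant_inv_mult)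
    also have "\<dots> = spow (\<^bold>*) (x \<^bold>* c) n \<^bold>* y"
      using V by (simp add: in_variety_def)
    also have "\<dots> = ?m (spow ?m x n) y"
      by (simp add: spow_def variant_mult_eq funpow_mult_right)
    finally show ?thesis .
  qed
  ultimately show ?thesis
    using drazin_inverse_variant[of c] semigroup_variant
    unfolding in_variety_def drazin_inverse_def by auto
qed

lemma unary_epigroup_variant:
  "unary_epigroup (variant_mult (\<^bold>*) c) (variant_inv (\<^bold>*) u c)"
  unfolding unary_epigroup_def epigroup_def
  using semigroup_variant drazin_inverse_variant
    semigroup.drazin_inverse_imp[OF semigroup_variant] by blast

end

end

theorem theorem6:
  fixes m :: "'a \<Rightarrow> 'a \<Rightarrow> 'a" and u :: "'a \<Rightarrow> 'a"
  shows
    "(unary_epigroup m u \<longrightarrow>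
        (\<forall>c. unary_epigroup (variant_mult m c) (variant_inv m u c)) \<and>
        (\<forall>n>0. in_variety n m u \<longrightarrow>
           (\<forall>c. in_variety n (variant_mult m c) (variant_inv m u c)))) \<and>
     (\<forall>n>0. \<forall>(s :: 'a \<Rightarrow> 'a \<Rightarrow> 'a) (v :: 'a \<Rightarrow> 'a). in_variety n s v \<longrightarrow>
        (\<forall>c. in_variety n (variant_mult s c) (variant_inv s v c)))"
proof -
  have epi: "unary_epigroup (variant_mult m c) (variant_inv m u c)"
    if "unary_epigroup m u" for c
  proof -
    interpret semigroup m
      using that by (simp add: unary_epigroup_def epigroup_def)
    show ?thesis
      by (rule unary_epigroup_variant, rule is_pseudoinverse_imp_drazin_inverse)
        (use that in \<open>simp add: unary_epigroup_def\<close>)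
  qed
  have var: "in_variety n (variant_mult s c) (variant_inv s v c)"
    if n: "n > 0" and V: "in_variety n s v"
    for n c and s :: "'a \<Rightarrow> 'a \<Rightarrow> 'a" and v :: "'a \<Rightarrow> 'a"
  proof -
    interpret semigroup s
      using V by (simp add: in_variety_def)
    show ?thesis
      \<comment> \<open>The Drazin property comes from the identities themselves, which covers every
        member of the variety.\<close>
      by (rule in_variety_variant[OF in_variety_imp_drazin_inverse[OF n V] n V])
  qed
  show ?thesis using epi var by blast
qed

end
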